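(* Let $p_1=(1,\{(0,1),(1,0)\})$ and $p_2=(1,\{(0,0),(1,1)\})$ be mesh patterns of length $1$. Let $F(x)=\sum_{n\ge 0} n!\,x^n$. Then the two patterns have the same distribution, $$F(x,q):=\sum_{n\ge 0}x^n\sum_{\pi\in S_n}q^{p_1(\pi)}=\sum_{n\ge 0}x^n\sum_{\pi\in S_n}q^{p_2(\pi)},$$ and, if $A(x)=\sum_{n\ge0}|S_n(p_1)|x^n=\sum_{n\ge0}|S_n(p_2)|x^n$ denotes the generating function for permutations avoiding $p_1$ (equivalently $p_2$), then, as formal power series in $x$, $$A(x)=\frac{F(x)}{1+xF(x)},\qquad F(x,q)=\frac{F(x)}{1+x(1-q)F(x)}.$$
   Context: $S_n$ is the set of permutations $\pi=\pi_1\cdots\pi_n$ of $\{1,\dots,n\}$ ($S_0$ contains only the empty permutation). A mesh pattern of length $1$ is a pair $(1,R)$ with $R\subseteq\{0,1\}\times\{0,1\}$. An element $\pi_m$ of $\pi\in S_n$ is an occurrence of $(1,R)$ if for each $(i,j)\in R$ there is no element of $\pi$ in the corresponding region: $i=0$ means positions to the left of $m$, $i=1$ positions to the right of $m$; $j=0$ means values less than $\pi_m$, $j=1$ values greater than $\pi_m$. So an occurrence of $p_1$ (a "strong fixed point") is an element having no larger element to its left and no smaller element to its right; an occurrence of $p_2$ is an element having no smaller element to its left and no larger element to its right. $p(\pi)$ is the number of occurrences of $p$ in $\pi$, and $S_n(p)$ is the set of $\pi\in S_n$ with $p(\pi)=0$. *)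

theory Defs
  imports
    "HOL-Combinatorics.Permutations"
    "HOL-Computational_Algebra.Formal_Power_Series"
    "HOL-Computational_Algebra.Polynomial_Factorial"
begin

definition Sn :: "nat \<Rightarrow> (nat \<Rightarrow> nat) set" where
  "Sn n = {\<pi>. \<pi> permutes {1..n}}"

text \<open>A mesh pattern of length 1 is represented by its set \<open>R \<subseteq> {0,1} \<times> {0,1}\<close> of
  shaded boxes. The following are the positions of the elements of \<open>\<pi>\<close> that lie in
  box \<open>(i, j)\<close> relative to the element at position \<open>m\<close>.\<close>

definition mesh1_box :: "nat \<Rightarrow> (nat \<Rightarrow> nat) \<Rightarrow> nat \<Rightarrow> nat \<times> nat \<Rightarrow> nat set" where
  "mesh1_box n \<pi> m = (\<lambda>(i, j). {k \<in> {1..n}.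
     (i = 0 \<and> k < m \<or> i = 1 \<and> m < k) \<and>
     (j = 0 \<and> \<pi> k < \<pi> m \<or> j = 1 \<and> \<pi> m < \<pi> k)})"

definition mesh1_occurrence :: "(nat \<times> nat) set \<Rightarrow> nat \<Rightarrow> (nat \<Rightarrow> nat) \<Rightarrow> nat \<Rightarrow> bool" where
  "mesh1_occurrence R n \<pi> m \<longleftrightarrow> m \<in> {1..n} \<and> (\<forall>b\<in>R. mesh1_box n \<pi> m b = {})"

definition mesh1_count :: "(nat \<times> nat) set \<Rightarrow> nat \<Rightarrow> (nat \<Rightarrow> nat) \<Rightarrow> nat" where
  "mesh1_count R n \<pi> = card {m. mesh1_occurrence R n \<pi> m}"

definition Sn_avoiding :: "(nat \<times> nat) set \<Rightarrow> nat \<Rightarrow> (nat \<Rightarrow> nat) set" where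
  "Sn_avoiding R n = {\<pi> \<in> Sn n. mesh1_count R n \<pi> = 0}"

definition patt1 :: "(nat \<times> nat) set" where
  "patt1 = {(0, 1), (1, 0)}"

definition patt2 :: "(nat \<times> nat) set" where
  "patt2 = {(0, 0), (1, 1)}"

definition fact_gf :: "'a::comm_ring_1 fps" where
  "fact_gf = Abs_fps (\<lambda>n. of_nat (fact n))"

definition avoiding_gf :: "(nat \<times> nat) set \<Rightarrow> 'a::comm_ring_1 fps" where
  "avoiding_gf R = Abs_fps (\<lambda>n. of_nat (card (Sn_avoiding R n)))"

definition distribution_gf :: "(nat \<times> nat) set \<Rightarrow> 'a::comm_ring_1 \<Rightarrow> 'a fps" where
  "distribution_gf R q = Abs_fps (\<lambda>n. \<Sum>\<pi>\<in>Sn n. q ^ mesh1_count R n \<pi>)"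

text \<open>The indeterminate \<open>q\<close>, as an element of the fraction field of \<open>\<int>[q]\<close>. The coefficients
  of \<open>distribution_gf R indet_q\<close> are polynomials in \<open>q\<close>; they are embedded into
  the fraction field because division of formal power series requires
  an inverse operation on the coefficients.\<close>

definition indet_q :: "int poly fract" where
  "indet_q = to_fract [:0, 1:]"

end

theory Submission
  imports Defs
begin

text \<open>Complementing the values of a permutation exchanges the lower and the upper boxes, hence
  turns occurrences of \<open>patt1\<close> into occurrences of \<open>patt2\<close>. This gives the equidistribution, and
  it remains to treat \<open>patt1\<close>.

  An element that is larger than everything to its left and smaller than everything to its
  right is a fixed point \<open>m\<close> which splits \<open>\<pi>\<close>: the entries before it form an arbitrary permutation
  of size \<open>m - 1\<close>, and those after it an arbitrary permutation of size \<open>n - m\<close>, whose strong fixed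
  points are exactly the ones of \<open>\<pi>\<close> beyond \<open>m\<close>. If \<open>\<pi>\<close> has \<open>c\<close> strong fixed points, the geometric
  sum \<open>q ^ c = 1 + (q - 1) * (q ^ (c - 1) + \<dots> + 1)\<close> can be read as having one term for each
  strong fixed point \<open>m\<close>, with exponent the number of strong fixed points beyond \<open>m\<close>. Summing over
  all \<open>\<pi>\<close> and splitting at \<open>m\<close>, one obtains \<open>F(x,q) = F(x) + (q - 1) x F(x) F(x,q)\<close>, which
  is the stated formula. The argument works for every element \<open>q\<close> of a field: the indeterminate
  is one instance, and \<open>q = 0\<close> is another, in which only the permutations without occurrences
  survive because \<open>0 ^ 0 = 1\<close>.\<close>

lemma finite_Sn: "finite (Sn n)"
  by (simp add: Sn_def finite_permutations)

lemma card_Sn: "card (Sn n) = fact n"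
  by (simp add: Sn_def card_permutations)

definition occurrences :: "(nat \<times> nat) set \<Rightarrow> nat \<Rightarrow> (nat \<Rightarrow> nat) \<Rightarrow> nat set" where
  "occurrences R n \<pi> = {m. mesh1_occurrence R n \<pi> m}"

lemma mesh1_count_eq_card: "mesh1_count R n \<pi> = card (occurrences R n \<pi>)"
  by (simp add: mesh1_count_def occurrences_def)

lemma occurrences_subset: "occurrences R n \<pi> \<subseteq> {1..n}"
  by (auto simp: occurrences_def mesh1_occurrence_def)

lemma finite_occurrences: "finite (occurrences R n \<pi>)"
  by (rule finite_subset[OF occurrences_subset]) simp


section \<open>Complementation\<close>

definition complement :: "nat \<Rightarrow> nat \<Rightarrow> nat" where
  "complement n i = (if i \<in> {1..n} then n + 1 - i else i)"

lemma complement_involution: "complement n \<circ> complement n = id"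
  by (auto simp: complement_def fun_eq_iff)

lemma complement_permutes: "complement n permutes {1..n}"
proof (rule bij_imp_permutes)
  show "bij_betw (complement n) {1..n} {1..n}"
    by (rule bij_betw_byWitness[where f' = "complement n"]) (auto simp: complement_def)
qed (auto simp: complement_def)

lemma complement_bij_Sn: "bij_betw ((\<circ>) (complement n)) (Sn n) (Sn n)"
proof (rule bij_betw_byWitness[where f' = "(\<circ>) (complement n)"])
  show "\<forall>\<pi>\<in>Sn n. complement n \<circ> (complement n \<circ> \<pi>) = \<pi>"
    and "\<forall>\<pi>\<in>Sn n. complement n \<circ> (complement n \<circ> \<pi>) = \<pi>"
    by (simp_all add: comp_assoc[symmetric] complement_involution)
  show "(\<circ>) (complement n) ` Sn n \<subseteq> Sn n" and "(\<circ>) (complement n) ` Sn n \<subseteq> Sn n"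
    using permutes_compose[OF _ complement_permutes] by (auto simp only: Sn_def)
qed

text \<open>Complementing reverses the order of values and keeps positions, so box \<open>(i, 0)\<close> becomes box
  \<open>(i, 1)\<close> and conversely; this maps the shaded boxes of one pattern to those of the other.
  Occurrences even stay at the same positions.\<close>

lemma occurrences_complement:
  assumes "\<pi> \<in> Sn n"
  shows "occurrences patt1 n (complement n \<circ> \<pi>) = occurrences patt2 n \<pi>"
proof -
  have less: "complement n (\<pi> k) < complement n (\<pi> m) \<longleftrightarrow> \<pi> m < \<pi> k"
    if "k \<in> {1..n}" "m \<in> {1..n}" for k m
  proof -
    have "\<pi> k \<in> {1..n}" "\<pi> m \<in> {1..n}"
      using that assms by (simp_all only: Sn_def mem_Collect_eq permutes_in_image)
    then show ?thesis by (auto simp: complement_def)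
  qed
  have "mesh1_box n (complement n \<circ> \<pi>) m (i, 1) = mesh1_box n \<pi> m (i, 0)"
    and "mesh1_box n (complement n \<circ> \<pi>) m (i, 0) = mesh1_box n \<pi> m (i, 1)"
    if "m \<in> {1..n}" for m i
    using that less by (auto simp: mesh1_box_def)
  then show ?thesis
    by (auto simp: occurrences_def mesh1_occurrence_def patt1_def patt2_def)
qed

lemma distribution_gf_patt1_eq_patt2:
  "distribution_gf patt1 q = distribution_gf patt2 q"
proof -
  have "(\<Sum>\<pi>\<in>Sn n. q ^ mesh1_count patt1 n \<pi>) = (\<Sum>\<pi>\<in>Sn n. q ^ mesh1_count patt2 n \<pi>)" for n
    by (subst sum.reindex_bij_betw[OF complement_bij_Sn, symmetric])
       (simp add: mesh1_count_eq_card occurrences_complement)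
  then show ?thesis by (simp add: distribution_gf_def)
qed

lemma avoiding_gf_eq_distribution_gf_0: "avoiding_gf R = distribution_gf R 0"
proof -
  have "(\<Sum>\<pi>\<in>Sn n. (0::'a) ^ mesh1_count R n \<pi>) = of_nat (card (Sn_avoiding R n))" for n
    by (simp add: power_0_left Sn_avoiding_def finite_Sn sum.If_cases Collect_conj_eq)
  then show ?thesis by (simp add: avoiding_gf_def distribution_gf_def)
qed


section \<open>Splitting a permutation at a strong fixed point\<close>

lemma mem_occurrences_patt1:
  assumes "\<pi> \<in> Sn n"
  shows "m \<in> occurrences patt1 n \<pi> \<longleftrightarrow>
    m \<in> {1..n} \<and> (\<forall>k\<in>{1..n}. (k < m \<longrightarrow> \<pi> k < \<pi> m) \<and> (m < k \<longrightarrow> \<pi> m < \<pi> k))"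
proof -
  have "inj \<pi>" using assms by (simp add: Sn_def permutes_inj)
  then have "\<not> \<pi> m < \<pi> k \<longleftrightarrow> \<pi> k < \<pi> m" if "k < m \<or> m < k" for k
    using that injD[of \<pi> k m] by (auto simp: not_less le_less)
  then have "m \<in> {1..n} \<and> (\<forall>k\<in>{1..n}. (k < m \<longrightarrow> \<pi> k < \<pi> m) \<and> (m < k \<longrightarrow> \<pi> m < \<pi> k)) \<longleftrightarrow>
      m \<in> {1..n} \<and> (\<forall>k\<in>{1..n}. (k < m \<longrightarrow> \<not> \<pi> m < \<pi> k) \<and> (m < k \<longrightarrow> \<not> \<pi> k < \<pi> m))"
    by (meson not_less_iff_gr_or_eq)
  also have "\<dots> \<longleftrightarrow> m \<in> occurrences patt1 n \<pi>"
    unfolding occurrences_def mesh1_occurrence_def patt1_def mesh1_box_def by auto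
  finally show ?thesis by blast
qed

text \<open>By injectivity, \<open>\<pi> m\<close> has at least \<open>m - 1\<close> values in \<open>{1..n}\<close> below it and at least \<open>n - m\<close>
  values above it, so it can only be \<open>m\<close>.\<close>

lemma occurrence_patt1_fixed:
  assumes "\<pi> \<in> Sn n" and "m \<in> occurrences patt1 n \<pi>"
  shows "\<pi> m = m"
proof -
  have perm: "\<pi> permutes {1..n}" using assms(1) by (simp add: Sn_def)
  then have inj: "inj \<pi>" by (rule permutes_inj)
  have occ: "m \<in> {1..n}" "\<And>k. k \<in> {1..n} \<Longrightarrow> k < m \<Longrightarrow> \<pi> k < \<pi> m"
      "\<And>k. k \<in> {1..n} \<Longrightarrow> m < k \<Longrightarrow> \<pi> m < \<pi> k"
    using assms(2) unfolding mem_occurrences_patt1[OF assms(1)] by blast+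
  have range: "1 \<le> \<pi> k" "\<pi> k \<le> n" if "k \<in> {1..n}" for k
    using that permutes_in_image[OF perm, of k] by auto
  have "\<pi> ` {1..<m} \<subseteq> {1..<\<pi> m}" using occ range by auto
  then have "card {1..<m} \<le> card {1..<\<pi> m}"
    by (rule card_inj_on_le[OF inj_on_subset[OF inj subset_UNIV]]) simp
  moreover have "\<pi> ` {m<..n} \<subseteq> {\<pi> m<..n}" using occ range by auto
  then have "card {m<..n} \<le> card {\<pi> m<..n}"
    by (rule card_inj_on_le[OF inj_on_subset[OF inj subset_UNIV]]) simp
  ultimately show ?thesis using occ(1) range[OF occ(1)] by auto
qed

text \<open>The permutation with \<open>\<alpha>\<close> before the fixed point \<open>m\<close> and \<open>\<beta>\<close> after it. Elements of \<open>Sn\<close> fix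
  \<open>0\<close>, so the second branch yields the value \<open>m\<close> at \<open>m\<close> itself, and it is the identity
  beyond the range of \<open>\<beta>\<close>.\<close>

definition join_at :: "nat \<Rightarrow> (nat \<Rightarrow> nat) \<times> (nat \<Rightarrow> nat) \<Rightarrow> nat \<Rightarrow> nat" where
  "join_at m = (\<lambda>(\<alpha>, \<beta>) i. if i < m then \<alpha> i else m + \<beta> (i - m))"

text \<open>The inverse of \<open>join_at m\<close> on permutations that have a strong fixed point at \<open>m\<close>. The truncated
  subtraction is harmless there, since all values from position \<open>m\<close> on are at least \<open>m\<close>.\<close>

definition split_at :: "nat \<Rightarrow> (nat \<Rightarrow> nat) \<Rightarrow> (nat \<Rightarrow> nat) \<times> (nat \<Rightarrow> nat)" where
  "split_at m \<pi> = (\<lambda>i. if i < m then \<pi> i else i, \<lambda>i. \<pi> (m + i) - m)"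

lemma Sn_outside: "\<pi> \<in> Sn n \<Longrightarrow> i \<notin> {1..n} \<Longrightarrow> \<pi> i = i"
  by (simp only: Sn_def mem_Collect_eq) (rule permutes_not_in)

lemma Sn_range: "\<pi> \<in> Sn n \<Longrightarrow> \<pi> i \<in> {1..n} \<longleftrightarrow> i \<in> {1..n}"
  by (simp only: Sn_def mem_Collect_eq permutes_in_image)

lemma SnI:
  assumes "\<And>i. i \<in> {1..n} \<Longrightarrow> \<pi> i \<in> {1..n}" and "inj_on \<pi> {1..n}"
    and "\<And>i. i \<notin> {1..n} \<Longrightarrow> \<pi> i = i"
  shows "\<pi> \<in> Sn n"
proof -
  have "\<pi> ` {1..n} = {1..n}" using assms(1,2) by (intro endo_inj_surj) auto
  then show ?thesis
    unfolding Sn_def mem_Collect_eq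
    by (intro bij_imp_permutes bij_betw_imageI assms(2,3))
qed

context
  fixes m n :: nat
  assumes m: "m \<in> {1..n}"
begin

lemma join_at_in_Sn:
  assumes \<alpha>: "\<alpha> \<in> Sn (m - 1)" and \<beta>: "\<beta> \<in> Sn (n - m)"
  shows "join_at m (\<alpha>, \<beta>) \<in> Sn n"
proof (rule SnI)
  have inj: "inj \<alpha>" "inj \<beta>" using assms by (simp_all add: Sn_def permutes_inj)
  have less: "\<alpha> i < m" if "i < m" for i
    using Sn_range[OF \<alpha>, of i] Sn_outside[OF \<alpha>, of i] that by (cases "i = 0") auto
  show "join_at m (\<alpha>, \<beta>) i \<in> {1..n}" if "i \<in> {1..n}" for i
    using Sn_range[OF \<alpha>, of i] Sn_range[OF \<beta>, of "i - m"] Sn_outside[OF \<beta>, of "i - m"] that m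
    by (auto simp: join_at_def)
  show "inj_on (join_at m (\<alpha>, \<beta>)) {1..n}"
  proof (rule inj_onI)
    fix i j assume "join_at m (\<alpha>, \<beta>) i = join_at m (\<alpha>, \<beta>) j"
    then show "i = j"
      using less[of i] less[of j] injD[OF inj(1), of i j] injD[OF inj(2), of "i - m" "j - m"]
      by (auto simp: join_at_def split: if_splits)
  qed
  show "join_at m (\<alpha>, \<beta>) i = i" if "i \<notin> {1..n}" for i
  proof (cases "i = 0")
    case True
    then show ?thesis using Sn_outside[OF \<alpha>, of 0] m by (simp add: join_at_def)
  next
    case False
    then have "n < i" using that by simp
    then have "i - m \<notin> {1..n - m}" using m by auto
    then show ?thesis using Sn_outside[OF \<beta>] \<open>n < i\<close> m by (simp add: join_at_def)
  qed
qed

text \<open>Everything up to \<open>m\<close> is smaller than everything after \<open>m\<close>. Hence the entries of \<open>\<alpha>\<close> and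
  \<open>m\<close> itself do not affect whether an element beyond \<open>m\<close> is a strong fixed point; only \<open>\<beta>\<close> does.\<close>

lemma occurrences_join_at:
  assumes \<alpha>: "\<alpha> \<in> Sn (m - 1)" and \<beta>: "\<beta> \<in> Sn (n - m)"
  shows "m \<in> occurrences patt1 n (join_at m (\<alpha>, \<beta>))"
    and "{k \<in> occurrences patt1 n (join_at m (\<alpha>, \<beta>)). m < k} = (+) m ` occurrences patt1 (n - m) \<beta>"
proof -
  note in_Sn = join_at_in_Sn[OF assms]
  have low: "join_at m (\<alpha>, \<beta>) i < m" if "i < m" for i
    using Sn_range[OF \<alpha>, of i] Sn_outside[OF \<alpha>, of i] that
    by (cases "i = 0") (auto simp: join_at_def)
  have at: "join_at m (\<alpha>, \<beta>) m = m"
    using Sn_outside[OF \<beta>, of 0] by (simp add: join_at_def)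
  have high: "join_at m (\<alpha>, \<beta>) (m + j) = m + \<beta> j" for j
    by (simp add: join_at_def)
  have pos: "0 < \<beta> j" if "j \<in> {1..n - m}" for j
    using Sn_range[OF \<beta>, of j] that by auto
  have above: "m < join_at m (\<alpha>, \<beta>) i" if "i \<in> {1..n}" "m < i" for i
  proof -
    have "i - m \<in> {1..n - m}" using that by auto
    then show ?thesis using high[of "i - m"] pos[of "i - m"] that by simp
  qed
  show "m \<in> occurrences patt1 n (join_at m (\<alpha>, \<beta>))"
    using m low at above by (simp add: mem_occurrences_patt1[OF in_Sn])
  have shift: "m + j \<in> occurrences patt1 n (join_at m (\<alpha>, \<beta>)) \<longleftrightarrow> j \<in> occurrences patt1 (n - m) \<beta>"
    if "0 < j" for j
  proof
    assume L: "m + j \<in> occurrences patt1 n (join_at m (\<alpha>, \<beta>))"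
    then have j: "j \<in> {1..n - m}"
      using \<open>0 < j\<close> by (auto simp: mem_occurrences_patt1[OF in_Sn])
    moreover have "(k < j \<longrightarrow> \<beta> k < \<beta> j) \<and> (j < k \<longrightarrow> \<beta> j < \<beta> k)" if "k \<in> {1..n - m}" for k
    proof -
      have "m + k \<in> {1..n}" using that by auto
      then have "(m + k < m + j \<longrightarrow> m + \<beta> k < m + \<beta> j) \<and> (m + j < m + k \<longrightarrow> m + \<beta> j < m + \<beta> k)"
        using L unfolding mem_occurrences_patt1[OF in_Sn] high[symmetric] by blast
      then show ?thesis by simp
    qed
    ultimately show "j \<in> occurrences patt1 (n - m) \<beta>"
      by (simp add: mem_occurrences_patt1[OF \<beta>])
  next
    assume R: "j \<in> occurrences patt1 (n - m) \<beta>"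
    then have j: "j \<in> {1..n - m}" by (simp add: mem_occurrences_patt1[OF \<beta>])
    have "(k < m + j \<longrightarrow> join_at m (\<alpha>, \<beta>) k < m + \<beta> j) \<and> (m + j < k \<longrightarrow> m + \<beta> j < join_at m (\<alpha>, \<beta>) k)"
      if k: "k \<in> {1..n}" for k
    proof (cases "k \<le> m")
      case True
      then have "join_at m (\<alpha>, \<beta>) k \<le> m" using low[of k] at by (cases "k = m") auto
      then show ?thesis using pos[OF j] True by auto
    next
      case False
      then have "k - m \<in> {1..n - m}" using k by auto
      then have "(k - m < j \<longrightarrow> \<beta> (k - m) < \<beta> j) \<and> (j < k - m \<longrightarrow> \<beta> j < \<beta> (k - m))"
        using R unfolding mem_occurrences_patt1[OF \<beta>] by blast
      then show ?thesis using high[of "k - m"] False by auto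
    qed
    then show "m + j \<in> occurrences patt1 n (join_at m (\<alpha>, \<beta>))"
      using j by (auto simp: mem_occurrences_patt1[OF in_Sn] high)
  qed
  show "{k \<in> occurrences patt1 n (join_at m (\<alpha>, \<beta>)). m < k} = (+) m ` occurrences patt1 (n - m) \<beta>"
  proof (intro set_eqI iffI)
    fix k assume "k \<in> {k \<in> occurrences patt1 n (join_at m (\<alpha>, \<beta>)). m < k}"
    then have "k = m + (k - m)" "k - m \<in> occurrences patt1 (n - m) \<beta>"
      using shift[of "k - m"] by auto
    then show "k \<in> (+) m ` occurrences patt1 (n - m) \<beta>" by blast
  next
    fix k assume "k \<in> (+) m ` occurrences patt1 (n - m) \<beta>"
    then obtain j where "k = m + j" "j \<in> occurrences patt1 (n - m) \<beta>" by blast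
    moreover from this have "0 < j" using occurrences_subset by fastforce
    ultimately show "k \<in> {k \<in> occurrences patt1 n (join_at m (\<alpha>, \<beta>)). m < k}"
      using shift by auto
  qed
qed

lemma split_at_in_Sn:
  assumes \<pi>: "\<pi> \<in> Sn n" and occ: "m \<in> occurrences patt1 n \<pi>"
  shows "split_at m \<pi> \<in> Sn (m - 1) \<times> Sn (n - m)" and "join_at m (split_at m \<pi>) = \<pi>"
proof -
  have inj: "inj \<pi>" using \<pi> by (simp add: Sn_def permutes_inj)
  have fixed: "\<pi> m = m" by (rule occurrence_patt1_fixed[OF assms])
  have low: "\<pi> i < m" if "i < m" "1 \<le> i" for i
    using occ that m by (auto simp: mem_occurrences_patt1[OF \<pi>] fixed)
  have high: "m \<le> \<pi> i" if "m \<le> i" for i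
    using occ that m fixed Sn_outside[OF \<pi>, of i]
    by (cases "i = m"; cases "i \<le> n") (auto simp: mem_occurrences_patt1[OF \<pi>] less_imp_le)
  have "(\<lambda>i. if i < m then \<pi> i else i) \<in> Sn (m - 1)"
  proof (rule SnI)
    show "(if i < m then \<pi> i else i) \<in> {1..m - 1}" if "i \<in> {1..m - 1}" for i
      using Sn_range[OF \<pi>, of i] low[of i] that m by auto
    show "inj_on (\<lambda>i. if i < m then \<pi> i else i) {1..m - 1}"
    proof (rule inj_onI)
      fix i j
      assume "i \<in> {1..m - 1}" "j \<in> {1..m - 1}"
        and "(if i < m then \<pi> i else i) = (if j < m then \<pi> j else j)"
      then have "\<pi> i = \<pi> j" by (auto split: if_splits)
      then show "i = j" by (rule injD[OF inj])
    qed
    show "(if i < m then \<pi> i else i) = i" if "i \<notin> {1..m - 1}" for i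
      using Sn_outside[OF \<pi>, of i] that by auto
  qed
  moreover have "(\<lambda>i. \<pi> (m + i) - m) \<in> Sn (n - m)"
  proof (rule SnI)
    show "\<pi> (m + i) - m \<in> {1..n - m}" if "i \<in> {1..n - m}" for i
    proof -
      have "\<pi> (m + i) \<noteq> m" using injD[OF inj, of "m + i" m] fixed that by auto
      then show ?thesis using high[of "m + i"] Sn_range[OF \<pi>, of "m + i"] that by auto
    qed
    show "inj_on (\<lambda>i. \<pi> (m + i) - m) {1..n - m}"
    proof (rule inj_onI)
      fix i j assume "\<pi> (m + i) - m = \<pi> (m + j) - m"
      then have "\<pi> (m + i) = \<pi> (m + j)" using high[of "m + i"] high[of "m + j"] by simp
      then have "m + i = m + j" by (rule injD[OF inj])
      then show "i = j" by simp
    qed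
    show "\<pi> (m + i) - m = i" if "i \<notin> {1..n - m}" for i
      using Sn_outside[OF \<pi>, of "m + i"] that m fixed by (cases "i = 0") auto
  qed
  ultimately show "split_at m \<pi> \<in> Sn (m - 1) \<times> Sn (n - m)" by (simp add: split_at_def)
  show "join_at m (split_at m \<pi>) = \<pi>"
    using high by (auto simp: fun_eq_iff join_at_def split_at_def)
qed

lemma split_at_join_at:
  assumes "\<alpha> \<in> Sn (m - 1)"
  shows "split_at m (join_at m (\<alpha>, \<beta>)) = (\<alpha>, \<beta>)"
proof -
  have "\<alpha> i = i" if "\<not> i < m" for i
    using that m by (intro Sn_outside[OF assms]) auto
  then show ?thesis by (auto simp: fun_eq_iff split_at_def join_at_def)
qed

lemma bij_betw_join_at:
  "bij_betw (join_at m) (Sn (m - 1) \<times> Sn (n - m)) {\<pi> \<in> Sn n. m \<in> occurrences patt1 n \<pi>}"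
proof (rule bij_betw_byWitness[where f' = "split_at m"])
  show "\<forall>p\<in>Sn (m - 1) \<times> Sn (n - m). split_at m (join_at m p) = p"
    using split_at_join_at by blast
  show "\<forall>\<pi>\<in>{\<pi> \<in> Sn n. m \<in> occurrences patt1 n \<pi>}. join_at m (split_at m \<pi>) = \<pi>"
    using split_at_in_Sn(2) by blast
  show "join_at m ` (Sn (m - 1) \<times> Sn (n - m)) \<subseteq> {\<pi> \<in> Sn n. m \<in> occurrences patt1 n \<pi>}"
    using join_at_in_Sn occurrences_join_at(1) by blast
  show "split_at m ` {\<pi> \<in> Sn n. m \<in> occurrences patt1 n \<pi>} \<subseteq> Sn (m - 1) \<times> Sn (n - m)"
    using split_at_in_Sn(1) by blast
qed

text \<open>The weight of \<open>join_at m (\<alpha>, \<beta>)\<close> depends on \<open>\<beta>\<close> only, so summing over \<open>\<alpha>\<close> contributes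
  the number of permutations of size \<open>m - 1\<close>.\<close>

lemma sum_occurrences_beyond:
  fixes q :: "'a::comm_ring_1"
  shows "(\<Sum>\<pi> | \<pi> \<in> Sn n \<and> m \<in> occurrences patt1 n \<pi>. q ^ card {k \<in> occurrences patt1 n \<pi>. m < k})
    = of_nat (fact (m - 1)) * (\<Sum>\<beta>\<in>Sn (n - m). q ^ mesh1_count patt1 (n - m) \<beta>)"
proof -
  have "(\<Sum>\<pi> | \<pi> \<in> Sn n \<and> m \<in> occurrences patt1 n \<pi>. q ^ card {k \<in> occurrences patt1 n \<pi>. m < k})
    = (\<Sum>(\<alpha>, \<beta>)\<in>Sn (m - 1) \<times> Sn (n - m). q ^ mesh1_count patt1 (n - m) \<beta>)"
    by (subst sum.reindex_bij_betw[OF bij_betw_join_at, symmetric], rule sum.cong)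
       (auto simp: occurrences_join_at(2) card_image mesh1_count_eq_card)
  also have "\<dots> = of_nat (fact (m - 1)) * (\<Sum>\<beta>\<in>Sn (n - m). q ^ mesh1_count patt1 (n - m) \<beta>)"
    by (simp add: sum.cartesian_product[symmetric] card_Sn)
  finally show ?thesis .
qed

end


section \<open>The functional equation\<close>

text \<open>The cardinalities of \<open>{k \<in> M. m < k}\<close> for \<open>m \<in> M\<close> are \<open>0, \<dots>, card M - 1\<close>, each taken once,
  so this is a geometric sum.\<close>

lemma geometric_sum_over_set:
  fixes q :: "'a::comm_ring_1" and M :: "nat set"
  assumes "finite M"
  shows "q ^ card M = 1 + (q - 1) * (\<Sum>m\<in>M. q ^ card {k \<in> M. m < k})"
  using assms
proof (induction M rule: finite_linorder_min_induct)
  case empty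
  then show ?case by simp
next
  case (insert b A)
  have b: "b \<notin> A" "{k \<in> insert b A. b < k} = A" using insert.hyps by auto
  have "{k \<in> insert b A. m < k} = {k \<in> A. m < k}" if "m \<in> A" for m
    using insert.hyps that by (auto dest: less_asym)
  then have "(\<Sum>m\<in>insert b A. q ^ card {k \<in> insert b A. m < k})
      = q ^ card A + (\<Sum>m\<in>A. q ^ card {k \<in> A. m < k})"
    using b insert.hyps(1) by simp
  moreover have "q ^ card (insert b A) = q * q ^ card A"
    using b insert.hyps(1) by simp
  ultimately show ?case using insert.IH by (simp add: algebra_simps)
qed

text \<open>Apply the geometric sum to the set of strong fixed points of each permutation, and exchange
  the order of summation so that the position \<open>m\<close> comes first.\<close>

lemma distribution_patt1_recurrence:
  fixes q :: "'a::comm_ring_1"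
  shows "(\<Sum>\<pi>\<in>Sn n. q ^ mesh1_count patt1 n \<pi>) = of_nat (fact n)
    + (q - 1) * (\<Sum>m=1..n. of_nat (fact (m - 1)) * (\<Sum>\<beta>\<in>Sn (n - m). q ^ mesh1_count patt1 (n - m) \<beta>))"
proof -
  let ?w = "\<lambda>\<pi> m. q ^ card {k \<in> occurrences patt1 n \<pi>. m < k}"
  have "(\<Sum>\<pi>\<in>Sn n. q ^ mesh1_count patt1 n \<pi>)
      = (\<Sum>\<pi>\<in>Sn n. 1 + (q - 1) * (\<Sum>m\<in>occurrences patt1 n \<pi>. ?w \<pi> m))"
    unfolding mesh1_count_eq_card
    by (intro sum.cong refl geometric_sum_over_set finite_occurrences)
  also have "\<dots> = of_nat (fact n) + (q - 1) * (\<Sum>\<pi>\<in>Sn n. \<Sum>m\<in>occurrences patt1 n \<pi>. ?w \<pi> m)"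
    by (simp only: sum.distrib sum_constant card_Sn mult_1_right sum_distrib_left[symmetric])
  also have "(\<Sum>\<pi>\<in>Sn n. \<Sum>m\<in>occurrences patt1 n \<pi>. ?w \<pi> m)
      = (\<Sum>\<pi>\<in>Sn n. \<Sum>m | m \<in> {1..n} \<and> m \<in> occurrences patt1 n \<pi>. ?w \<pi> m)"
  proof (intro sum.cong refl)
    show "occurrences patt1 n \<pi> = {m. m \<in> {1..n} \<and> m \<in> occurrences patt1 n \<pi>}" for \<pi>
      using occurrences_subset[of patt1 n \<pi>] by blast
  qed
  also have "\<dots> = (\<Sum>m=1..n. \<Sum>\<pi> | \<pi> \<in> Sn n \<and> m \<in> occurrences patt1 n \<pi>. ?w \<pi> m)"
    by (rule sum.swap_restrict) (simp_all add: finite_Sn)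
  also have "\<dots> = (\<Sum>m=1..n. of_nat (fact (m - 1)) * (\<Sum>\<beta>\<in>Sn (n - m). q ^ mesh1_count patt1 (n - m) \<beta>))"
    by (intro sum.cong refl sum_occurrences_beyond)
  finally show ?thesis .
qed

unbundle fps_syntax

text \<open>The recurrence is a convolution; the factor \<open>fps_X\<close> accounts for the strong fixed point that
  separates the two parts.\<close>

lemma distribution_gf_patt1_equation:
  fixes q :: "'a::comm_ring_1"
  shows "distribution_gf patt1 q
    = fact_gf + fps_const (q - 1) * (fps_X * (fact_gf * distribution_gf patt1 q))"
proof (rule fps_ext)
  fix n
  let ?d = "\<lambda>n. \<Sum>\<beta>\<in>Sn n. q ^ mesh1_count patt1 n \<beta>"
  have "(\<Sum>m=1..n. of_nat (fact (m - 1)) * ?d (n - m))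
      = (fps_X * (fact_gf * distribution_gf patt1 q)) $ n"
  proof (cases n)
    case 0
    then show ?thesis by simp
  next
    case (Suc n')
    have "(\<Sum>m=1..n. of_nat (fact (m - 1)) * ?d (n - m)) = (\<Sum>m=0..n'. of_nat (fact m) * ?d (n' - m))"
      unfolding Suc One_nat_def by (simp only: sum.shift_bounds_cl_Suc_ivl diff_Suc_Suc diff_zero)
    also have "\<dots> = (fact_gf * distribution_gf patt1 q) $ n'"
      by (simp only: fps_mult_nth fact_gf_def distribution_gf_def fps_nth_Abs_fps)
    finally show ?thesis by (simp only: Suc) simp
  qed
  then show "distribution_gf patt1 q $ n
      = (fact_gf + fps_const (q - 1) * (fps_X * (fact_gf * distribution_gf patt1 q))) $ n"
    using distribution_patt1_recurrence[of q n]
    by (simp add: distribution_gf_def fact_gf_def)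
qed

lemma distribution_gf_patt1_closed_form:
  fixes q :: "'a::field"
  shows "distribution_gf patt1 q = fact_gf / (1 + fps_X * fps_const (1 - q) * fact_gf)"
proof -
  let ?D = "1 + fps_X * fps_const (1 - q) * fact_gf :: 'a fps"
  have "?D $ 0 = 1" by (simp add: mult.assoc)
  then have "?D \<noteq> 0" by (metis fps_zero_nth zero_neq_one)
  have "f = g * (1 + x * - c * f)" if "g = f + c * (x * (f * g))" for f g c x :: "'a fps"
    using that by algebra
  from this[OF distribution_gf_patt1_equation]
  have "fact_gf = distribution_gf patt1 q * ?D" by (simp only: fps_const_neg minus_diff_eq)
  then show ?thesis using \<open>?D \<noteq> 0\<close> by (metis nonzero_mult_div_cancel_right)
qed

theorem theorem1p1:
  shows "distribution_gf patt1 indet_q = distribution_gf patt2 indet_q \<and>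
    (avoiding_gf patt1 :: rat fps) = avoiding_gf patt2 \<and>
    (avoiding_gf patt1 :: rat fps) = fact_gf / (1 + fps_X * fact_gf) \<and>
    distribution_gf patt1 indet_q
      = fact_gf / (1 + fps_X * fps_const (1 - indet_q) * fact_gf)"
proof (intro conjI)
  show "distribution_gf patt1 indet_q = distribution_gf patt2 indet_q"
    by (rule distribution_gf_patt1_eq_patt2)
  show "(avoiding_gf patt1 :: rat fps) = avoiding_gf patt2"
    unfolding avoiding_gf_eq_distribution_gf_0 by (rule distribution_gf_patt1_eq_patt2)
  show "(avoiding_gf patt1 :: rat fps) = fact_gf / (1 + fps_X * fact_gf)"
    unfolding avoiding_gf_eq_distribution_gf_0 distribution_gf_patt1_closed_form by simp
  show "distribution_gf patt1 indet_q
      = fact_gf / (1 + fps_X * fps_const (1 - indet_q) * fact_gf)"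
    by (rule distribution_gf_patt1_closed_form)
qed

end
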